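(* Let $\mathcal{H}, \mathcal{K}$ be closed subspaces of $L^2$, let $a_1, a_2 \in \mathscr{G}L^\infty$ with $a_i \mathcal{K} = \mathcal{H}$ for $i = 1,2$, and let $\phi, \psi \in L^\infty$ with $\phi = \bar a_2 \psi a_1$, so that $T_\phi^{\mathcal{K}} = E\, T_\psi^{\mathcal{H}} F$ with $E = T_{\bar a_2}^{\mathcal{H},\mathcal{K}}$ and $F = T_{a_1}^{\mathcal{K},\mathcal{H}} = M_{a_1}|_{\mathcal{K}}$. Then the following are equivalent: (a) the identity $T_\phi^{\mathcal{K}} = E\, T_\psi^{\mathcal{H}} F$ is a unitary equivalence; (b) $E = F^{-1} = F^*$; (c) $T_{1 - \bar a_2 a_1}^{\mathcal{K}} = 0$ and $T_{1 - |a_1|^2}^{\mathcal{K}} = 0$.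
   Context: $L^2 = L^2(\mathbb{T}, m)$, with $m$ normalized Lebesgue measure on the unit circle $\mathbb{T}$, and $L^\infty = L^\infty(\mathbb{T},m)$ (complex-valued functions). $\mathscr{G}L^\infty = \{g \in L^\infty : 1/g \in L^\infty\}$. $M_a$ is the multiplication operator $f\mapsto af$ on $L^2$, and $a\mathcal{K} = \{af: f \in \mathcal{K}\}$. $P_{\mathcal{N}}$ is the orthogonal projection of $L^2$ onto the closed subspace $\mathcal{N}$. For closed subspaces $\mathcal{M}, \mathcal{N}$ of $L^2$ and $\phi \in L^\infty$, $T_\phi^{\mathcal{M},\mathcal{N}} : \mathcal{M} \to \mathcal{N}$ is $T_\phi^{\mathcal{M},\mathcal{N}} f = P_{\mathcal{N}}(\phi f)$, and $T_\phi^{\mathcal{M}} = T_\phi^{\mathcal{M},\mathcal{M}}$. The identity $T_\phi^{\mathcal{K}} = E T_\psi^{\mathcal{H}} F$ "is a unitary equivalence" if $F:\mathcal{K}\to\mathcal{H}$ is unitary (an isometric isomorphism) and $E = F^{-1}$. *)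

theory Defs
  imports "HOL-Analysis.Analysis"
begin

section \<open>Normalized Lebesgue measure on the unit circle\<close>

definition circle_measure :: "complex measure" where
  "circle_measure =
     distr (uniform_measure lborel {0..<2 * pi}) (restrict_space borel (sphere 0 1)) cis"

lemma measurable_cis_circle:
  "cis \<in> measurable (uniform_measure lborel {0..<2 * pi}) (restrict_space borel (sphere 0 1))"
proof -
  have "cis \<in> borel_measurable borel"
    by (intro borel_measurable_continuous_onI continuous_intros)
  thus ?thesis
    by (intro measurable_restrict_space2) (auto simp: measurable_def space_uniform_measure)
qed

lemma space_circle_measure [simp]: "space circle_measure = sphere 0 1"
  by (simp add: circle_measure_def space_restrict_space)

lemma emeasure_circle_measure_space: "emeasure circle_measure (sphere 0 1) = 1"
proof -
  have "sphere 0 1 \<in> sets (restrict_space borel (sphere (0 :: complex) 1))"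
    by (auto simp: sets_restrict_space)
  hence "emeasure circle_measure (sphere 0 1)
      = emeasure (uniform_measure lborel {0..<2 * pi})
          (cis -` sphere 0 1 \<inter> space (uniform_measure lborel {0..<2 * pi}))"
    unfolding circle_measure_def by (intro emeasure_distr measurable_cis_circle)
  also have "cis -` sphere 0 1 \<inter> space (uniform_measure lborel {0..<2 * pi}) = UNIV"
    by (auto simp: space_uniform_measure)
  also have "emeasure (uniform_measure lborel {0..<2 * pi}) UNIV = 1"
    by (subst emeasure_uniform_measure) (auto intro!: ennreal_divide_self)
  finally show ?thesis .
qed


section \<open>The space \<open>L\<^sup>2\<close> of the circle\<close>

definition square_integrable :: "(complex \<Rightarrow> complex) \<Rightarrow> bool" where
  "square_integrable f \<longleftrightarrow>
     f \<in> borel_measurable circle_measure \<and> integrable circle_measure (\<lambda>z. (cmod (f z))\<^sup>2)"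

definition L2_rel :: "(complex \<Rightarrow> complex) \<Rightarrow> (complex \<Rightarrow> complex) \<Rightarrow> bool" where
  "L2_rel f g \<longleftrightarrow>
     square_integrable f \<and> square_integrable g \<and> (AE z in circle_measure. f z = g z)"

lemma square_integrable_0: "square_integrable (\<lambda>z. 0)"
  by (simp add: square_integrable_def)

lemma square_integrable_add:
  assumes "square_integrable f" "square_integrable g"
  shows "square_integrable (\<lambda>z. f z + g z)"
proof -
  have [measurable]: "f \<in> borel_measurable circle_measure" "g \<in> borel_measurable circle_measure"
    using assms by (auto simp: square_integrable_def)
  have "integrable circle_measure (\<lambda>z. 2 * (cmod (f z))\<^sup>2 + 2 * (cmod (g z))\<^sup>2)"
    using assms by (auto simp: square_integrable_def)
  hence "integrable circle_measure (\<lambda>z. (cmod (f z + g z))\<^sup>2)"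
  proof (rule Bochner_Integration.integrable_bound)
    have "(cmod (f z + g z))\<^sup>2 \<le> 2 * (cmod (f z))\<^sup>2 + 2 * (cmod (g z))\<^sup>2" for z
    proof -
      have "(cmod (f z + g z))\<^sup>2 \<le> (cmod (f z) + cmod (g z))\<^sup>2"
        by (intro power_mono norm_triangle_ineq) auto
      also have "\<dots> \<le> 2 * (cmod (f z))\<^sup>2 + 2 * (cmod (g z))\<^sup>2"
        using zero_le_power2[of "cmod (f z) - cmod (g z)"]
        by (simp add: power2_eq_square algebra_simps)
      finally show ?thesis .
    qed
    thus "AE z in circle_measure. norm ((cmod (f z + g z))\<^sup>2)
            \<le> norm (2 * (cmod (f z))\<^sup>2 + 2 * (cmod (g z))\<^sup>2)"
      by simp
  qed measurable
  thus ?thesis by (simp add: square_integrable_def)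
qed

lemma square_integrable_cmult:
  assumes "square_integrable f"
  shows "square_integrable (\<lambda>z. c * f z)"
  using assms by (auto simp: square_integrable_def norm_mult power_mult_distrib)

lemma integrable_mult_cnj:
  assumes "square_integrable f" "square_integrable g"
  shows "integrable circle_measure (\<lambda>z. f z * cnj (g z))"
proof -
  have [measurable]: "f \<in> borel_measurable circle_measure" "g \<in> borel_measurable circle_measure"
    using assms by (auto simp: square_integrable_def)
  have "integrable circle_measure (\<lambda>z. (cmod (f z))\<^sup>2 + (cmod (g z))\<^sup>2)"
    using assms by (auto simp: square_integrable_def)
  thus ?thesis
  proof (rule Bochner_Integration.integrable_bound)
    show "(\<lambda>z. f z * cnj (g z)) \<in> borel_measurable circle_measure"
      by (intro borel_measurable_times borel_measurable_continuous_on[of cnj] continuous_intros) auto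
    have "cmod (f z * cnj (g z)) \<le> norm ((cmod (f z))\<^sup>2 + (cmod (g z))\<^sup>2)" for z
    proof -
      have "2 * (cmod (f z) * cmod (g z)) \<le> (cmod (f z))\<^sup>2 + (cmod (g z))\<^sup>2"
        using zero_le_power2[of "cmod (f z) - cmod (g z)"]
        by (simp add: power2_eq_square algebra_simps)
      moreover have "0 \<le> cmod (f z) * cmod (g z)" by simp
      ultimately show ?thesis unfolding norm_mult complex_mod_cnj real_norm_def by linarith
    qed
    thus "AE z in circle_measure. cmod (f z * cnj (g z)) \<le> norm ((cmod (f z))\<^sup>2 + (cmod (g z))\<^sup>2)"
      by simp
  qed
qed

quotient_type L2 = "complex \<Rightarrow> complex" / partial: L2_rel
proof (rule part_equivpI)
  show "\<exists>f. L2_rel f f"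
    using square_integrable_0 by (auto simp: L2_rel_def)
  show "symp L2_rel"
    by (auto simp: symp_def L2_rel_def)
  show "transp L2_rel"
    unfolding transp_def L2_rel_def by (auto)
qed

lift_definition scaleC_L2 :: "complex \<Rightarrow> L2 \<Rightarrow> L2" is "\<lambda>c f z. c * f z"
  by (auto simp: L2_rel_def square_integrable_cmult)

lift_definition cinner_L2 :: "L2 \<Rightarrow> L2 \<Rightarrow> complex" is
  "\<lambda>f g. LINT z|circle_measure. f z * cnj (g z)"
proof -
  fix f f' g g' assume "L2_rel f f'" "L2_rel g g'"
  moreover from this have "AE z in circle_measure. f z * cnj (g z) = f' z * cnj (g' z)"
    unfolding L2_rel_def by (auto)
  ultimately show "(LINT z|circle_measure. f z * cnj (g z)) = (LINT z|circle_measure. f' z * cnj (g' z))"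
    using integrable_mult_cnj by (intro integral_cong_AE) (auto simp: L2_rel_def)
qed

instantiation L2 :: real_inner
begin

lift_definition zero_L2 :: L2 is "\<lambda>z. 0"
  by (simp add: L2_rel_def square_integrable_0)

lift_definition plus_L2 :: "L2 \<Rightarrow> L2 \<Rightarrow> L2" is "\<lambda>f g z. f z + g z"
  by (auto simp: L2_rel_def square_integrable_add)

definition uminus_L2 :: "L2 \<Rightarrow> L2" where "uminus_L2 f = scaleC_L2 (-1) f"

definition minus_L2 :: "L2 \<Rightarrow> L2 \<Rightarrow> L2" where "minus_L2 f g = f + (- g)"

definition scaleR_L2 :: "real \<Rightarrow> L2 \<Rightarrow> L2" where
  "scaleR_L2 r f = scaleC_L2 (complex_of_real r) f"

definition inner_L2 :: "L2 \<Rightarrow> L2 \<Rightarrow> real" where "inner_L2 f g = Re (cinner_L2 f g)"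

definition norm_L2 :: "L2 \<Rightarrow> real" where "norm_L2 f = sqrt (inner f f)"

definition dist_L2 :: "L2 \<Rightarrow> L2 \<Rightarrow> real" where "dist_L2 f g = norm (f - g)"

definition sgn_L2 :: "L2 \<Rightarrow> L2" where "sgn_L2 f = scaleR (inverse (norm f)) f"

definition uniformity_L2 :: "(L2 \<times> L2) filter" where
  "uniformity_L2 = (INF e\<in>{0<..}. principal {(f, g). dist f g < e})"

definition open_L2 :: "L2 set \<Rightarrow> bool" where
  "open_L2 U \<longleftrightarrow> (\<forall>f\<in>U. \<forall>\<^sub>F (f', g) in uniformity. f' = f \<longrightarrow> g \<in> U)"

instance
proof
  fix f g h :: L2 and r s :: real
  show add_assoc: "f + g + h = f + (g + h)"
    by transfer (simp add: L2_rel_def square_integrable_add add.assoc)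
  show "f + g = g + f"
    by transfer (simp add: L2_rel_def square_integrable_add add.commute)
  show "0 + f = f"
    by transfer (simp add: L2_rel_def)
  show "- f + f = 0"
    unfolding uminus_L2_def
    by transfer (auto simp: L2_rel_def square_integrable_0
        intro!: square_integrable_add square_integrable_cmult[where c = "-1", simplified])
  show "f - g = f + (- g)" by (simp add: minus_L2_def)
  show "r *\<^sub>R (f + g) = r *\<^sub>R f + r *\<^sub>R g"
    unfolding scaleR_L2_def
    by transfer (simp add: L2_rel_def square_integrable_add square_integrable_cmult distrib_left)
  show "(r + s) *\<^sub>R f = r *\<^sub>R f + s *\<^sub>R f"
    unfolding scaleR_L2_def
    by transfer (simp add: L2_rel_def square_integrable_add square_integrable_cmult distrib_right)
  show "r *\<^sub>R s *\<^sub>R f = (r * s) *\<^sub>R f"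
    unfolding scaleR_L2_def
    by transfer (simp add: L2_rel_def square_integrable_cmult mult.assoc)
  show "1 *\<^sub>R f = f"
    unfolding scaleR_L2_def by transfer (simp add: L2_rel_def)
  show "dist f g = norm (f - g)" by (simp add: dist_L2_def)
  show "sgn f = scaleR (inverse (norm f)) f" by (simp add: sgn_L2_def)
  show "norm f = sqrt (inner f f)" by (simp add: norm_L2_def)
  show "inner f g = inner g f"
    unfolding inner_L2_def
  proof transfer
    fix f g
    have "(LINT z|circle_measure. f z * cnj (g z))
        = (LINT z|circle_measure. cnj (g z * cnj (f z)))"
      by (simp add: mult.commute)
    also have "\<dots> = cnj (LINT z|circle_measure. g z * cnj (f z))"
      by (rule Bochner_Integration.integral_cnj)
    finally show "Re (LINT z|circle_measure. f z * cnj (g z))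
        = Re (LINT z|circle_measure. g z * cnj (f z))"
      by simp
  qed
  show "inner (f + g) h = inner f h + inner g h"
    unfolding inner_L2_def
    by transfer
       (simp add: L2_rel_def distrib_right Bochner_Integration.integral_add integrable_mult_cnj)
  show "inner (r *\<^sub>R f) g = r * inner f g"
    unfolding inner_L2_def scaleR_L2_def
    by transfer (simp add: mult.assoc)
  have self: "(LINT z|circle_measure. f z * cnj (f z))
      = complex_of_real (LINT z|circle_measure. (cmod (f z))\<^sup>2)" for f :: "complex \<Rightarrow> complex"
    by (simp flip: complex_norm_square of_real_power)
  show "0 \<le> inner f f"
    unfolding inner_L2_def by transfer (simp add: self)
  show "inner f f = 0 \<longleftrightarrow> f = 0"
    unfolding inner_L2_def
    by transfer
       (auto simp: self L2_rel_def square_integrable_0 square_integrable_def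
             integral_nonneg_eq_0_iff_AE)
  show "(uniformity :: (L2 \<times> L2) filter) = (INF e\<in>{0<..}. principal {(f, g). dist f g < e})"
    by (rule uniformity_L2_def)
  show "open U \<longleftrightarrow> (\<forall>f\<in>U. \<forall>\<^sub>F (f', g) in uniformity. f' = f \<longrightarrow> g \<in> U)" for U :: "L2 set"
    by (rule open_L2_def)
qed

end

text \<open>The topology, and hence \<^const>\<open>closed\<close>, on \<^typ>\<open>L2\<close> is the one of the norm
  \<open>(\<integral> |f|\<^sup>2 dm)\<^bsup>1/2\<^esup>\<close>.\<close>

definition closed_csubspace :: "L2 set \<Rightarrow> bool" where
  "closed_csubspace M \<longleftrightarrow>
     0 \<in> M \<and> (\<forall>f\<in>M. \<forall>g\<in>M. f + g \<in> M) \<and> (\<forall>c. \<forall>f\<in>M. scaleC_L2 c f \<in> M) \<and> closed M"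


section \<open>\<open>L\<^sup>\<infinity>\<close> and multiplication operators\<close>

text \<open>Elements of \<open>L\<^sup>\<infinity>\<close> are handled through representatives, so that identities between
  them are to be read almost everywhere.\<close>

definition Linf :: "(complex \<Rightarrow> complex) set" where
  "Linf = {a \<in> borel_measurable circle_measure.
             \<exists>C. AE z in circle_measure. cmod (a z) \<le> C}"

text \<open>As \<open>1 / 0 = 0\<close> in HOL, it has to be required explicitly that \<open>1 / g\<close> is defined
  almost everywhere.\<close>

definition GLinf :: "(complex \<Rightarrow> complex) set" where
  "GLinf = {g \<in> Linf. (AE z in circle_measure. g z \<noteq> 0) \<and> (\<lambda>z. 1 / g z) \<in> Linf}"

lemma square_integrable_mult:
  assumes "a \<in> Linf" "square_integrable f"
  shows "square_integrable (\<lambda>z. a z * f z)"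
proof -
  obtain C where C: "AE z in circle_measure. cmod (a z) \<le> C"
    using assms by (auto simp: Linf_def)
  have [measurable]: "a \<in> borel_measurable circle_measure" "f \<in> borel_measurable circle_measure"
    using assms by (auto simp: Linf_def square_integrable_def)
  have "AE z in circle_measure. norm ((cmod (a z * f z))\<^sup>2) \<le> norm (C\<^sup>2 * (cmod (f z))\<^sup>2)"
    using C by eventually_elim
      (auto simp: norm_mult power_mult_distrib intro!: mult_right_mono power_mono)
  moreover have "integrable circle_measure (\<lambda>z. C\<^sup>2 * (cmod (f z))\<^sup>2)"
    using assms(2) by (simp add: square_integrable_def)
  ultimately have "integrable circle_measure (\<lambda>z. (cmod (a z * f z))\<^sup>2)"
    by (rule Bochner_Integration.integrable_bound[rotated 2]) measurable
  thus ?thesis by (simp add: square_integrable_def)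
qed

text \<open>\<open>M\<^sub>a\<close>; the value \<open>0\<close> for \<open>a\<close> outside \<^const>\<open>Linf\<close> is a dummy.\<close>

lift_definition mult_L2 :: "(complex \<Rightarrow> complex) \<Rightarrow> L2 \<Rightarrow> L2" is
  "\<lambda>a f z. if a \<in> Linf then a z * f z else 0"
proof -
  fix a f g :: "complex \<Rightarrow> complex" assume "L2_rel f g"
  thus "L2_rel (\<lambda>z. if a \<in> Linf then a z * f z else 0) (\<lambda>z. if a \<in> Linf then a z * g z else 0)"
    by (cases "a \<in> Linf")
       (auto simp: L2_rel_def square_integrable_0 square_integrable_mult)
qed


section \<open>Operators between closed subspaces\<close>

text \<open>An operator from \<open>M\<close> to \<open>N\<close> is a function on \<^typ>\<open>L2\<close> that is \<^const>\<open>undefined\<close>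
  outside \<open>M\<close>, as in \<^theory>\<open>HOL-Library.FuncSet\<close>; equality of operators with domain \<open>M\<close> is
  then equality of functions, and composition is \<^const>\<open>compose\<close>.\<close>

definition proj_L2 :: "L2 set \<Rightarrow> L2 \<Rightarrow> L2" where
  "proj_L2 N f = (THE g. g \<in> N \<and> (\<forall>h\<in>N. cinner_L2 (f - g) h = 0))"

definition toeplitz :: "L2 set \<Rightarrow> L2 set \<Rightarrow> (complex \<Rightarrow> complex) \<Rightarrow> L2 \<Rightarrow> L2" where
  "toeplitz M N \<phi> = (\<lambda>f\<in>M. proj_L2 N (mult_L2 \<phi> f))"

text \<open>For \<open>F : M \<rightarrow> N\<close>, the inverse and the Hilbert space adjoint, both \<open>N \<rightarrow> M\<close>.\<close>

definition inverse_op :: "L2 set \<Rightarrow> L2 set \<Rightarrow> (L2 \<Rightarrow> L2) \<Rightarrow> L2 \<Rightarrow> L2" where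
  "inverse_op M N F = (\<lambda>h\<in>N. inv_into M F h)"

definition adjoint_op :: "L2 set \<Rightarrow> L2 set \<Rightarrow> (L2 \<Rightarrow> L2) \<Rightarrow> L2 \<Rightarrow> L2" where
  "adjoint_op M N F = (\<lambda>h\<in>N. THE g. g \<in> M \<and> (\<forall>f\<in>M. cinner_L2 (F f) h = cinner_L2 f g))"

definition unitary_op :: "L2 set \<Rightarrow> L2 set \<Rightarrow> (L2 \<Rightarrow> L2) \<Rightarrow> bool" where
  "unitary_op M N F \<longleftrightarrow>
     (\<forall>f\<in>M. \<forall>g\<in>M. F (f + g) = F f + F g) \<and> (\<forall>c. \<forall>f\<in>M. F (scaleC_L2 c f) = scaleC_L2 c (F f)) \<and>
     bij_betw F M N \<and> (\<forall>f\<in>M. norm (F f) = norm f)"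

text \<open>The identity \<open>A = E B F\<close>, for \<open>F : M \<rightarrow> N\<close>, \<open>B : N \<rightarrow> N\<close>, \<open>E : N \<rightarrow> M\<close> and \<open>A : M \<rightarrow> M\<close>,
  is a unitary equivalence.\<close>

definition is_unitary_equivalence ::
    "L2 set \<Rightarrow> L2 set \<Rightarrow> (L2 \<Rightarrow> L2) \<Rightarrow> (L2 \<Rightarrow> L2) \<Rightarrow> (L2 \<Rightarrow> L2) \<Rightarrow> (L2 \<Rightarrow> L2) \<Rightarrow> bool" where
  "is_unitary_equivalence M N A E B F \<longleftrightarrow>
     A = compose M E (compose M B F) \<and> unitary_op M N F \<and> E = inverse_op M N F"

end

theory Submission
  imports Defs
begin

text \<open>
  The map \<open>F\<close> is multiplication by \<open>a\<^sub>1\<close>. It is a bijection from \<open>K\<close> onto \<open>H\<close>, as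
  multiplication by \<open>1 / a\<^sub>1\<close> undoes it. For bounded \<open>b\<close> and \<open>f \<in> K\<close>, put
  \<open>G\<^sub>b h = P\<^sub>K (cnj b h)\<close> for \<open>h \<in> H\<close>. Then \<open>G\<^sub>b F f = P\<^sub>K (cnj b a\<^sub>1 f)\<close>, which differs from
  \<open>f = P\<^sub>K f\<close> by \<open>P\<^sub>K ((1 - cnj b a\<^sub>1) f)\<close>. So \<open>G\<^sub>b\<close> inverts \<open>F\<close> exactly when the Toeplitz
  operator on \<open>K\<close> with symbol \<open>1 - cnj b a\<^sub>1\<close> vanishes (\<open>toeplitz_cnj_eq_inverse_iff\<close> and
  \<open>toeplitz_one_minus_eq_0_iff\<close>).

  This is used for two choices of \<open>b\<close>. With \<open>b = a\<^sub>2\<close> the operator \<open>G\<^sub>b\<close> is \<open>E\<close>. With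
  \<open>b = a\<^sub>1\<close> it is the adjoint of \<open>F\<close> (\<open>adjoint_op_restrict_mult\<close>), and the symbol is
  \<open>1 - |a\<^sub>1|\<^sup>2\<close>. Hence the two halves of (b), namely \<open>E = F\<^sup>-\<^sup>1\<close> and \<open>F\<^sup>-\<^sup>1 = F\<^sup>*\<close>, match the
  two halves of (c). By polarization \<open>F\<^sup>* F = 1\<close> says that \<open>F\<close> is isometric
  (\<open>proj_mult_cnj_mult_eq_iff_isometric\<close>), and as \<open>F\<close> is bijective this is unitarity; so (a)
  and (b) agree. The factorization of the Toeplitz operator with symbol \<open>\<phi>\<close> comes from
  \<open>a\<^sub>2 K \<subseteq> H\<close>: what \<open>P\<^sub>H\<close> removes is orthogonal to \<open>a\<^sub>2 K\<close>, and so it becomes orthogonal to \<open>K\<close>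
  after multiplication by \<open>cnj a\<^sub>2\<close> (\<open>proj_mult_cnj_proj\<close>).

  All this presupposes that \<open>P\<^sub>K\<close> and \<open>P\<^sub>H\<close> exist, which rests on the Riesz--Fischer theorem
  \<open>complete_UNIV_L2\<close> and on the projection theorem \<open>exists_orthogonal_projection\<close>.
\<close>

section \<open>The projection theorem\<close>

text \<open>The projection is the point of \<open>S\<close> nearest to \<open>x\<close>. It is found as the limit of a minimizing
  sequence, and since \<open>S\<close> contains both \<open>g + h\<close> and \<open>g - h\<close>, minimality at \<open>g\<close> forces
  orthogonality.\<close>
lemma exists_orthogonal_projection:
  fixes S :: "'a::real_inner set"
  assumes S: "subspace S" "complete S"
  shows "\<exists>g\<in>S. \<forall>h\<in>S. inner (x - g) h = 0"
proof -
  define d where "d = (INF h\<in>S. dist x h)"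
  have ne: "S \<noteq> {}" and cvx: "convex S" and cl: "closed S"
    using S subspace_0 by (auto simp: subspace_imp_convex complete_imp_closed)
  have bdd: "bdd_below (dist x ` S)" by (rule bdd_belowI[of _ 0]) auto
  have dle: "d \<le> dist x h" if "h \<in> S" for h
    unfolding d_def using that bdd by (rule cINF_lower[rotated])
  have d0: "0 \<le> d" unfolding d_def using ne by (intro cINF_greatest) auto
  have "\<exists>h\<in>S. dist x h < d + 1 / real (Suc n)" for n
    using cINF_less_iff[OF ne bdd, of "d + 1 / real (Suc n)"] by (simp add: d_def)
  then obtain X where XS: "X n \<in> S" and Xd: "dist x (X n) < d + 1 / real (Suc n)" for n
    by metis
  have lim: "(\<lambda>n. d + 1 / real (Suc n)) \<longlonglongrightarrow> d"
    using LIMSEQ_inverse_real_of_nat_add[of d] by (simp add: inverse_eq_divide)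
  \<comment> \<open>The midpoint of two points of \<open>S\<close> is no closer to \<open>x\<close> than \<open>d\<close>, so the parallelogram law
    makes a minimizing sequence Cauchy.\<close>
  have par: "(dist (X m) (X n))\<^sup>2 \<le> 2 * ((dist x (X m))\<^sup>2 - d\<^sup>2) + 2 * ((dist x (X n))\<^sup>2 - d\<^sup>2)" for m n
  proof -
    define u v where "u = x - X m" and "v = x - X n"
    have "(1/2) *\<^sub>R X m + (1/2) *\<^sub>R X n \<in> S"
      using S XS by (intro subspace_add subspace_scale)
    hence "d \<le> dist x ((1/2) *\<^sub>R X m + (1/2) *\<^sub>R X n)" by (rule dle)
    also have "x - ((1/2) *\<^sub>R X m + (1/2) *\<^sub>R X n) = (1/2) *\<^sub>R (u + v)"
      by (simp add: u_def v_def algebra_simps flip: scaleR_left_distrib)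
    hence "dist x ((1/2) *\<^sub>R X m + (1/2) *\<^sub>R X n) = norm (u + v) / 2"
      unfolding dist_norm by simp
    finally have "(2 * d)\<^sup>2 \<le> (norm (u + v))\<^sup>2" using d0 by (intro power_mono) auto
    moreover have "dist (X m) (X n) = norm (u - v)"
      by (simp add: u_def v_def dist_norm norm_minus_commute)
    moreover have "(norm (u + v))\<^sup>2 + (norm (u - v))\<^sup>2 = 2 * (norm u)\<^sup>2 + 2 * (norm v)\<^sup>2"
      by (simp add: power2_norm_eq_inner algebra_simps inner_commute)
    ultimately show ?thesis by (simp add: u_def v_def dist_norm power_mult_distrib)
  qed
  have "(\<lambda>n. 4 * ((d + 1 / real (Suc n))\<^sup>2 - d\<^sup>2)) \<longlonglongrightarrow> 4 * (d\<^sup>2 - d\<^sup>2)"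
    by (intro tendsto_intros lim)
  hence lim0: "(\<lambda>n. 4 * ((d + 1 / real (Suc n))\<^sup>2 - d\<^sup>2)) \<longlonglongrightarrow> 0" by simp
  have "Cauchy X"
    unfolding Cauchy_def
  proof (intro allI impI)
    fix e :: real assume e: "0 < e"
    have "eventually (\<lambda>n. 4 * ((d + 1 / real (Suc n))\<^sup>2 - d\<^sup>2) < e\<^sup>2) sequentially"
      using lim0 e by (intro order_tendstoD(2)) auto
    then obtain N where N: "4 * ((d + 1 / real (Suc N))\<^sup>2 - d\<^sup>2) < e\<^sup>2"
      by (auto simp: eventually_sequentially)
    have bound: "(dist x (X n))\<^sup>2 \<le> (d + 1 / real (Suc N))\<^sup>2" if "n \<ge> N" for n
    proof -
      have "1 / real (Suc n) \<le> 1 / real (Suc N)" using that by (intro divide_left_mono) auto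
      thus ?thesis using Xd[of n] by (intro power_mono) auto
    qed
    have "(dist (X m) (X n))\<^sup>2 < e\<^sup>2" if "m \<ge> N" "n \<ge> N" for m n
      using par[of m n] bound[OF that(1)] bound[OF that(2)] N by argo
    hence "dist (X m) (X n) < e" if "m \<ge> N" "n \<ge> N" for m n
      using that e by (meson less_imp_le power2_less_imp_less)
    thus "\<exists>M. \<forall>m\<ge>M. \<forall>n\<ge>M. dist (X m) (X n) < e" by blast
  qed
  then obtain g where g: "g \<in> S" "X \<longlonglongrightarrow> g"
    using S(2) XS unfolding complete_def by blast
  have "dist x g \<le> d"
    using tendsto_dist[OF tendsto_const g(2)] lim
    by (rule LIMSEQ_le) (use Xd less_imp_le in blast)
  hence closest: "\<forall>z\<in>S. dist x g \<le> dist x z" using dle by fastforce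
  have "inner (x - g) h = 0" if h: "h \<in> S" for h
  proof -
    have "inner (x - g) ((g + h) - g) \<le> 0" "inner (x - g) ((g - h) - g) \<le> 0"
      using cvx cl g(1) closest h S(1)
      by (intro any_closest_point_dot[where S = S]; simp add: subspace_add subspace_diff)+
    thus ?thesis by (simp add: inner_diff_right)
  qed
  with g(1) show ?thesis by blast
qed

section \<open>Completeness of \<open>L\<^sup>2\<close>\<close>

lemma L2_cases:
  obtains f where "square_integrable f" "x = abs_L2 f"
proof -
  have "square_integrable (rep_L2 x)" "abs_L2 (rep_L2 x) = x"
    using Quotient3_rep_reflp[OF Quotient3_L2] Quotient3_abs_rep[OF Quotient3_L2]
    by (auto simp: L2_rel_def)
  thus ?thesis using that by metis
qed

lemma square_integrable_diff:
  assumes "square_integrable f" "square_integrable g"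
  shows "square_integrable (\<lambda>z. f z - g z)"
  using square_integrable_add[OF assms(1) square_integrable_cmult[OF assms(2), of "-1"]] by simp

lemma abs_L2_diff:
  assumes "square_integrable f" "square_integrable g"
  shows "abs_L2 f - abs_L2 g = abs_L2 (\<lambda>z. f z - g z)"
  using assms square_integrable_cmult[OF assms(2), of "-1"]
  by (simp add: minus_L2_def uminus_L2_def plus_L2.abs_eq scaleC_L2.abs_eq L2_rel_def)

lemma norm_abs_L2_power2:
  assumes "square_integrable f"
  shows "(norm (abs_L2 f))\<^sup>2 = (LINT z|circle_measure. (cmod (f z))\<^sup>2)"
proof -
  have "(norm (abs_L2 f))\<^sup>2 = Re (LINT z|circle_measure. f z * cnj (f z))"
    using assms by (simp add: power2_norm_eq_inner inner_L2_def cinner_L2.abs_eq L2_rel_def)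
  also have "\<dots> = (LINT z|circle_measure. (cmod (f z))\<^sup>2)"
    by (simp flip: complex_norm_square of_real_power)
  finally show ?thesis .
qed

lemma finite_measure_circle: "finite_measure circle_measure"
  by (rule finite_measureI) (simp add: emeasure_circle_measure_space)

lemma measure_circle_space: "measure circle_measure (sphere 0 1) = 1"
  by (simp add: measure_def emeasure_circle_measure_space)

lemma square_integrable_integrable:
  assumes "square_integrable f"
  shows "integrable circle_measure f"
proof -
  interpret finite_measure circle_measure by (rule finite_measure_circle)
  show ?thesis using integrable_mult_cnj[OF assms, of "\<lambda>_. 1"] by (simp add: square_integrable_def)
qed

text \<open>On a space of mass one the \<open>L\<^sup>1\<close> norm is at most the \<open>L\<^sup>2\<close> norm. The strict form is read off
  by integrating \<open>t \<le> e / 2 + t\<^sup>2 / (2 e)\<close>, which is \<open>(t - e)\<^sup>2 \<ge> 0\<close>.\<close>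
lemma integral_norm_less:
  assumes f: "square_integrable f" and e: "norm (abs_L2 f) < e"
  shows "(LINT z|circle_measure. cmod (f z)) < e"
proof -
  interpret finite_measure circle_measure by (rule finite_measure_circle)
  have e0: "0 < e" using e norm_ge_zero by (rule le_less_trans[rotated])
  have "(LINT z|circle_measure. cmod (f z)) \<le>
      (LINT z|circle_measure. e / 2 + (cmod (f z))\<^sup>2 / (2 * e))"
  proof (rule integral_mono)
    show "integrable circle_measure (\<lambda>z. cmod (f z))"
      using square_integrable_integrable[OF f] by simp
    show "integrable circle_measure (\<lambda>z. e / 2 + (cmod (f z))\<^sup>2 / (2 * e))"
      using f by (simp add: square_integrable_def)
    show "cmod (f z) \<le> e / 2 + (cmod (f z))\<^sup>2 / (2 * e)" for z
      using e0 zero_le_power2[of "cmod (f z) - e"] by (simp add: field_simps power2_eq_square)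
  qed
  also have "\<dots> = e / 2 + (norm (abs_L2 f))\<^sup>2 / (2 * e)"
    using f by (simp add: measure_circle_space norm_abs_L2_power2 square_integrable_def)
  also have "\<dots> < e / 2 + e\<^sup>2 / (2 * e)"
    using e e0 by (intro add_strict_left_mono divide_strict_right_mono power_strict_mono) auto
  also have "\<dots> = e" using e0 by (simp add: power2_eq_square)
  finally show ?thesis .
qed

text \<open>Riesz--Fischer. A Cauchy sequence in \<open>L\<^sup>2\<close> is Cauchy in \<open>L\<^sup>1\<close>, so a subsequence converges
  almost everywhere to some \<open>g\<close>. Fatou's lemma, applied along that subsequence, bounds the
  \<open>L\<^sup>2\<close> distance from \<open>g\<close> to every late term of the full sequence.\<close>
lemma complete_UNIV_L2: "complete (UNIV :: L2 set)"
  unfolding complete_def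
proof (intro allI impI)
  fix X :: "nat \<Rightarrow> L2" assume "(\<forall>n. X n \<in> UNIV) \<and> Cauchy X"
  hence X: "Cauchy X" by simp
  have "\<exists>f. square_integrable f \<and> X n = abs_L2 f" for n by (metis L2_cases)
  then obtain f where sq: "square_integrable (f n)" and Xf: "X n = abs_L2 (f n)" for n by metis
  have meas [measurable]: "f n \<in> borel_measurable circle_measure" for n
    using sq by (simp add: square_integrable_def)
  have dist: "dist (X m) (X n) = norm (abs_L2 (\<lambda>z. f m z - f n z))" for m n
    by (simp add: dist_norm Xf abs_L2_diff sq)
  have "\<exists>N. \<forall>i\<ge>N. \<forall>j\<ge>N. (LINT z|circle_measure. cmod (f i z - f j z)) < e" if "e > 0" for e
    using metric_CauchyD[OF X that] integral_norm_less square_integrable_diff sq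
    unfolding dist by meson
  then obtain r where r: "strict_mono r"
      and cauchy: "AE z in circle_measure. Cauchy (\<lambda>i. f (r i) z)"
    using cauchy_L1_AE_cauchy_subseq[of circle_measure f] square_integrable_integrable[OF sq]
    by blast
  define g where "g z = lim (\<lambda>i. f (r i) z)" for z
  have g_meas [measurable]: "g \<in> borel_measurable circle_measure"
    unfolding g_def by measurable
  have conv: "AE z in circle_measure. (\<lambda>i. f (r i) z) \<longlonglongrightarrow> g z"
    using cauchy by eventually_elim (simp add: g_def Cauchy_convergent_iff convergent_LIMSEQ_iff)
  have fatou: "(\<integral>\<^sup>+z. ennreal ((cmod (g z - f n z))\<^sup>2) \<partial>circle_measure) \<le> ennreal (e\<^sup>2)"
    if N: "\<forall>m\<ge>N. \<forall>n\<ge>N. dist (X m) (X n) < e" and n: "n \<ge> N" for e N n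
  proof -
    have "(\<integral>\<^sup>+z. ennreal ((cmod (g z - f n z))\<^sup>2) \<partial>circle_measure)
        = (\<integral>\<^sup>+z. liminf (\<lambda>i. ennreal ((cmod (f (r i) z - f n z))\<^sup>2)) \<partial>circle_measure)"
    proof (rule nn_integral_cong_AE)
      show "AE z in circle_measure. ennreal ((cmod (g z - f n z))\<^sup>2)
          = liminf (\<lambda>i. ennreal ((cmod (f (r i) z - f n z))\<^sup>2))"
        using conv by eventually_elim
          (intro lim_imp_Liminf[symmetric] tendsto_ennrealI tendsto_intros, auto)
    qed
    also have "\<dots> \<le> liminf (\<lambda>i. \<integral>\<^sup>+z. ennreal ((cmod (f (r i) z - f n z))\<^sup>2) \<partial>circle_measure)"
      by (rule nn_integral_liminf) measurable
    also have "\<dots> \<le> ennreal (e\<^sup>2)"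
    proof (rule Liminf_le)
      have "(\<integral>\<^sup>+z. ennreal ((cmod (f (r i) z - f n z))\<^sup>2) \<partial>circle_measure) \<le> ennreal (e\<^sup>2)"
        if "i \<ge> N" for i
      proof -
        \<comment> \<open>A strictly increasing \<open>r\<close> satisfies \<open>i \<le> r i\<close>, so the subsequence enters the
          tail no later than the sequence does.\<close>
        have "r i \<ge> N" using that seq_suble[OF r, of i] by simp
        hence "dist (X (r i)) (X n) < e" using N n by blast
        hence "(norm (abs_L2 (\<lambda>z. f (r i) z - f n z)))\<^sup>2 \<le> e\<^sup>2"
          unfolding dist by (intro power_mono) auto
        hence "(LINT z|circle_measure. (cmod (f (r i) z - f n z))\<^sup>2) \<le> e\<^sup>2"
          by (simp add: norm_abs_L2_power2 square_integrable_diff sq)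
        thus ?thesis
          using square_integrable_diff[OF sq sq, of "r i" n]
          by (subst nn_integral_eq_integral) (auto simp: square_integrable_def intro: ennreal_leI)
      qed
      thus "\<forall>\<^sub>F i in sequentially.
          (\<integral>\<^sup>+z. ennreal ((cmod (f (r i) z - f n z))\<^sup>2) \<partial>circle_measure) \<le> ennreal (e\<^sup>2)"
        by (auto simp: eventually_sequentially)
    qed auto
    finally show ?thesis .
  qed
  have diff: "square_integrable (\<lambda>z. g z - f n z)"
    if "\<forall>m\<ge>N. \<forall>n\<ge>N. dist (X m) (X n) < e" "n \<ge> N" for e N n
    unfolding square_integrable_def
    using fatou[OF that] by (auto intro!: integrableI_nonneg elim: le_less_trans)
  obtain N where "\<forall>m\<ge>N. \<forall>n\<ge>N. dist (X m) (X n) < 1"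
    using metric_CauchyD[OF X zero_less_one] by blast
  \<comment> \<open>A single square integrable difference suffices: add back \<open>f N\<close>.\<close>
  from square_integrable_add[OF diff[OF this order_refl] sq[of N]]
  have g: "square_integrable g" by simp
  have "X \<longlonglongrightarrow> abs_L2 g"
  proof (rule metric_LIMSEQ_I)
    fix e :: real assume e: "0 < e"
    then obtain N where N: "\<forall>m\<ge>N. \<forall>n\<ge>N. dist (X m) (X n) < e / 2"
      using metric_CauchyD[OF X, of "e/2"] by auto
    have "dist (X n) (abs_L2 g) < e" if n: "n \<ge> N" for n
    proof -
      have "ennreal ((norm (abs_L2 (\<lambda>z. g z - f n z)))\<^sup>2) \<le> ennreal ((e/2)\<^sup>2)"
        using fatou[OF N n] diff[OF N n]
        by (subst norm_abs_L2_power2)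
           (auto simp: nn_integral_eq_integral square_integrable_def)
      hence "norm (abs_L2 (\<lambda>z. g z - f n z)) \<le> e / 2"
        using e by (subst (asm) ennreal_le_iff) (auto intro: power2_le_imp_le)
      moreover have "dist (X n) (abs_L2 g) = norm (abs_L2 (\<lambda>z. g z - f n z))"
        by (subst dist_commute) (simp add: dist_norm Xf abs_L2_diff g sq)
      ultimately show ?thesis using e by simp
    qed
    thus "\<exists>N. \<forall>n\<ge>N. dist (X n) (abs_L2 g) < e" by blast
  qed
  thus "\<exists>l\<in>UNIV. X \<longlonglongrightarrow> l" by blast
qed

section \<open>The complex inner product and multiplication operators\<close>

text \<open>The complex inner product is determined by the real one. Additivity, polarization and the
  projection theorem can therefore be taken from real inner product spaces.\<close>
lemma cinner_L2_eq: "cinner_L2 x y = Complex (inner x y) (inner x (scaleC_L2 \<i> y))"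
proof -
  have "cinner_L2 x (scaleC_L2 \<i> y) = - \<i> * cinner_L2 x y"
  proof transfer
    fix f g
    have "(LINT z|circle_measure. f z * cnj (\<i> * g z))
        = (LINT z|circle_measure. - \<i> * (f z * cnj (g z)))"
      by (simp add: algebra_simps)
    thus "(LINT z|circle_measure. f z * cnj (\<i> * g z))
        = - \<i> * (LINT z|circle_measure. f z * cnj (g z))"
      by simp
  qed
  thus ?thesis by (simp add: inner_L2_def complex_eq_iff)
qed

lemma cinner_L2_diff_left: "cinner_L2 (x - y) h = cinner_L2 x h - cinner_L2 y h"
  by (simp add: cinner_L2_eq inner_diff_left complex_eq_iff)

lemma cinner_L2_commute: "cinner_L2 x y = cnj (cinner_L2 y x)"
proof transfer
  fix f g
  have "(LINT z|circle_measure. cnj (g z * cnj (f z))) = cnj (LINT z|circle_measure. g z * cnj (f z))"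
    by (rule Bochner_Integration.integral_cnj)
  thus "(LINT z|circle_measure. f z * cnj (g z)) = cnj (LINT z|circle_measure. g z * cnj (f z))"
    by (simp add: mult.commute)
qed

lemma cinner_L2_self_eq_0: "cinner_L2 x x = 0 \<Longrightarrow> x = 0"
  by (metis inner_L2_def inner_eq_zero_iff zero_complex.simps(1))

lemma Linf_mult:
  assumes "a \<in> Linf" "b \<in> Linf"
  shows "(\<lambda>z. a z * b z) \<in> Linf"
proof -
  obtain C D where "AE z in circle_measure. cmod (a z) \<le> C" "AE z in circle_measure. cmod (b z) \<le> D"
    using assms by (auto simp: Linf_def)
  hence "AE z in circle_measure. cmod (a z * b z) \<le> C * D"
    by eventually_elim (auto simp: norm_mult intro!: mult_mono intro: order_trans[OF norm_ge_zero])
  thus ?thesis using assms by (auto simp: Linf_def)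
qed

lemma Linf_diff:
  assumes "a \<in> Linf" "b \<in> Linf"
  shows "(\<lambda>z. a z - b z) \<in> Linf"
proof -
  obtain C D where "AE z in circle_measure. cmod (a z) \<le> C" "AE z in circle_measure. cmod (b z) \<le> D"
    using assms by (auto simp: Linf_def)
  hence "AE z in circle_measure. cmod (a z - b z) \<le> C + D"
    by eventually_elim (metis add_mono norm_triangle_ineq4 order_trans)
  thus ?thesis using assms by (auto simp: Linf_def)
qed

lemma Linf_cnj: "a \<in> Linf \<Longrightarrow> (\<lambda>z. cnj (a z)) \<in> Linf"
  by (auto simp: Linf_def intro!: borel_measurable_continuous_on[of cnj] continuous_intros)

lemma Linf_const: "(\<lambda>z. c) \<in> Linf"
  by (auto simp: Linf_def)

lemma mult_L2_add: "mult_L2 a (x + y) = mult_L2 a x + mult_L2 a y"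
  by (cases "a \<in> Linf"; transfer) (auto simp: L2_rel_def algebra_simps square_integrable_0
      intro!: square_integrable_add square_integrable_mult)

lemma mult_L2_scaleC: "mult_L2 a (scaleC_L2 c x) = scaleC_L2 c (mult_L2 a x)"
  by (cases "a \<in> Linf"; transfer) (auto simp: L2_rel_def algebra_simps square_integrable_0
      intro!: square_integrable_cmult square_integrable_mult)

lemma mult_L2_diff: "mult_L2 a (x - y) = mult_L2 a x - mult_L2 a y"
  by (simp add: minus_L2_def uminus_L2_def mult_L2_add mult_L2_scaleC)

lemma mult_L2_mult:
  assumes "a \<in> Linf" "b \<in> Linf"
  shows "mult_L2 a (mult_L2 b x) = mult_L2 (\<lambda>z. a z * b z) x"
  using assms by transfer
    (auto simp: L2_rel_def mult.assoc Linf_mult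
      intro!: square_integrable_mult simp flip: mult.assoc)

lemma mult_L2_cong_AE:
  assumes "a \<in> Linf" "b \<in> Linf" "AE z in circle_measure. a z = b z"
  shows "mult_L2 a x = mult_L2 b x"
  using assms by transfer (auto simp: L2_rel_def square_integrable_mult)

lemma mult_L2_one_minus:
  assumes "a \<in> Linf"
  shows "mult_L2 (\<lambda>z. 1 - a z) x = x - mult_L2 a x"
  using assms Linf_diff[OF Linf_const[of 1] assms] unfolding minus_L2_def uminus_L2_def
  by transfer (auto simp: L2_rel_def algebra_simps square_integrable_mult
      intro!: square_integrable_diff)

lemma mult_L2_inverse:
  assumes "a \<in> GLinf"
  shows "mult_L2 (\<lambda>z. 1 / a z) (mult_L2 a x) = x"
proof -
  have a: "a \<in> Linf" "(\<lambda>z. 1 / a z) \<in> Linf" "AE z in circle_measure. a z \<noteq> 0"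
    using assms by (auto simp: GLinf_def)
  have "mult_L2 (\<lambda>z. 1 / a z) (mult_L2 a x) = mult_L2 (\<lambda>z. 1) x"
    unfolding mult_L2_mult[OF a(2,1)]
  proof (rule mult_L2_cong_AE)
    show "AE z in circle_measure. 1 / a z * a z = 1" using a(3) by eventually_elim simp
  qed (intro Linf_mult Linf_const a)+
  also have "\<dots> = x"
    using Linf_const[of 1] by transfer (auto simp: L2_rel_def)
  finally show ?thesis .
qed

lemma cinner_mult_L2:
  assumes "a \<in> Linf"
  shows "cinner_L2 (mult_L2 a x) y = cinner_L2 x (mult_L2 (\<lambda>z. cnj (a z)) y)"
  using assms Linf_cnj[OF assms] by transfer (simp add: mult_ac)

lemma cinner_mult_cnj_L2:
  assumes "a \<in> Linf"
  shows "cinner_L2 (mult_L2 (\<lambda>z. cnj (a z)) x) y = cinner_L2 x (mult_L2 a y)"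
  using cinner_mult_L2[OF Linf_cnj[OF assms]] by simp

section \<open>Orthogonal projections and Toeplitz operators\<close>

lemma subspace_closed_csubspace:
  assumes "closed_csubspace N"
  shows "subspace N"
  using assms unfolding closed_csubspace_def subspace_def by (auto simp: scaleR_L2_def)

lemma proj_L2_eqI:
  assumes N: "closed_csubspace N" and g: "g \<in> N" "\<And>h. h \<in> N \<Longrightarrow> cinner_L2 (f - g) h = 0"
  shows "proj_L2 N f = g"
  unfolding proj_L2_def
proof (rule the_equality)
  fix g' assume g': "g' \<in> N \<and> (\<forall>h\<in>N. cinner_L2 (f - g') h = 0)"
  \<comment> \<open>The difference of two candidates lies in \<open>N\<close> and is orthogonal to \<open>N\<close>, hence to itself.\<close>
  have mem: "g - g' \<in> N"
    using subspace_diff[OF subspace_closed_csubspace[OF N]] g g' by blast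
  have "cinner_L2 (g - g') (g - g') = cinner_L2 ((f - g') - (f - g)) (g - g')" by simp
  also have "\<dots> = 0" unfolding cinner_L2_diff_left[of "f - g'"] using g(2) g' mem by simp
  finally show "g' = g" using cinner_L2_self_eq_0 by fastforce
qed (use g in auto)

text \<open>Real orthogonality to \<open>N\<close> gives complex orthogonality, because \<open>N\<close> is invariant under
  multiplication by \<open>\<i>\<close>.\<close>
lemma proj_L2:
  assumes N: "closed_csubspace N"
  shows proj_L2_mem: "proj_L2 N f \<in> N"
    and proj_L2_orthogonal: "h \<in> N \<Longrightarrow> cinner_L2 (f - proj_L2 N f) h = 0"
proof -
  have "complete N"
    using complete_Int_closed[OF complete_UNIV_L2, of N] N by (simp add: closed_csubspace_def)
  then obtain g where g: "g \<in> N" "\<forall>h\<in>N. inner (f - g) h = 0"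
    using exists_orthogonal_projection subspace_closed_csubspace[OF N] by blast
  have orth: "cinner_L2 (f - g) h = 0" if "h \<in> N" for h
    using g(2) that N by (simp add: cinner_L2_eq closed_csubspace_def complex_eq_iff)
  have "proj_L2 N f = g" using N g(1) orth by (rule proj_L2_eqI)
  thus "proj_L2 N f \<in> N" "h \<in> N \<Longrightarrow> cinner_L2 (f - proj_L2 N f) h = 0"
    using g(1) orth by auto
qed

lemma proj_L2_id: "closed_csubspace N \<Longrightarrow> f \<in> N \<Longrightarrow> proj_L2 N f = f"
  by (rule proj_L2_eqI) (auto simp: cinner_L2_eq complex_eq_iff)

lemma proj_L2_diff:
  assumes N: "closed_csubspace N"
  shows "proj_L2 N (f - g) = proj_L2 N f - proj_L2 N g"
proof (rule proj_L2_eqI[OF N])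
  show "proj_L2 N f - proj_L2 N g \<in> N"
    using N by (intro subspace_diff subspace_closed_csubspace proj_L2_mem)
  fix h assume h: "h \<in> N"
  have "f - g - (proj_L2 N f - proj_L2 N g) = (f - proj_L2 N f) - (g - proj_L2 N g)" by simp
  thus "cinner_L2 (f - g - (proj_L2 N f - proj_L2 N g)) h = 0"
    using proj_L2_orthogonal[OF N h] by (simp only: cinner_L2_diff_left[of "f - proj_L2 N f"]) simp
qed

text \<open>The error \<open>g - P\<^sub>H g\<close> is orthogonal to \<open>b K\<close>. Moving \<open>b\<close> across the inner product, \<open>cnj b\<close> times
  this error is orthogonal to \<open>K\<close>.\<close>
lemma proj_mult_cnj_proj:
  assumes K: "closed_csubspace K" and H: "closed_csubspace H"
    and b: "b \<in> Linf" "mult_L2 b ` K \<subseteq> H"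
  shows "proj_L2 K (mult_L2 (\<lambda>z. cnj (b z)) (proj_L2 H g)) = proj_L2 K (mult_L2 (\<lambda>z. cnj (b z)) g)"
proof -
  let ?d = "mult_L2 (\<lambda>z. cnj (b z)) (g - proj_L2 H g)"
  have "proj_L2 K ?d = 0"
  proof (rule proj_L2_eqI[OF K])
    show "0 \<in> K" using K by (simp add: closed_csubspace_def)
    show "cinner_L2 (?d - 0) h = 0" if "h \<in> K" for h
      using that b(2) proj_L2_orthogonal[OF H, of "mult_L2 b h" g]
      by (auto simp: cinner_mult_cnj_L2[OF b(1)])
  qed
  thus ?thesis by (simp add: mult_L2_diff proj_L2_diff[OF K])
qed

lemma toeplitz_eq_restrict_mult:
  assumes "closed_csubspace H" "mult_L2 a ` K \<subseteq> H"
  shows "toeplitz K H a = restrict (mult_L2 a) K"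
  using assms by (auto simp: toeplitz_def fun_eq_iff intro!: proj_L2_id)

text \<open>Moving \<open>a\<close> across the inner product turns the condition that singles out the value of the
  adjoint at \<open>h\<close> into the one that singles out the projection of \<open>cnj a h\<close>. So the two
  definite descriptions have the same predicate.\<close>
lemma adjoint_op_restrict_mult:
  assumes a: "a \<in> Linf"
  shows "adjoint_op K H (restrict (mult_L2 a) K) = toeplitz H K (\<lambda>z. cnj (a z))"
proof -
  have "(\<forall>f\<in>K. cinner_L2 (restrict (mult_L2 a) K f) h = cinner_L2 f g)
      \<longleftrightarrow> (\<forall>f\<in>K. cinner_L2 (mult_L2 (\<lambda>z. cnj (a z)) h - g) f = 0)" for h g
    by (auto simp: cinner_mult_L2[OF a] cinner_L2_diff_left
        cinner_L2_commute[of "mult_L2 (\<lambda>z. cnj (a z)) h"] cinner_L2_commute[of g])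
  thus ?thesis by (simp add: adjoint_op_def toeplitz_def proj_L2_def)
qed

text \<open>As \<open>a\<close> maps \<open>K\<close> onto \<open>H\<close>, equality with the inverse can be tested at the points \<open>a f\<close>, where
  the inverse takes the value \<open>f\<close>.\<close>
lemma toeplitz_cnj_eq_inverse_iff:
  assumes "bij_betw (mult_L2 a) K H"
  shows "toeplitz H K (\<lambda>z. cnj (b z)) = inverse_op K H (restrict (mult_L2 a) K)
     \<longleftrightarrow> (\<forall>f\<in>K. proj_L2 K (mult_L2 (\<lambda>z. cnj (b z)) (mult_L2 a f)) = f)"
proof -
  let ?F = "restrict (mult_L2 a) K"
  have inv: "inv_into K ?F (mult_L2 a f) = f" if "f \<in> K" for f
    using inv_into_f_f[of ?F K f] that assms by (simp add: bij_betw_def)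
  have "toeplitz H K (\<lambda>z. cnj (b z)) = inverse_op K H ?F
      \<longleftrightarrow> (\<forall>h\<in>mult_L2 a ` K. proj_L2 K (mult_L2 (\<lambda>z. cnj (b z)) h) = inv_into K ?F h)"
    using assms by (auto simp: toeplitz_def inverse_op_def fun_eq_iff restrict_def bij_betw_def)
  thus ?thesis by (simp add: inv)
qed

text \<open>For \<open>f \<in> K\<close> one has \<open>P\<^sub>K f = f\<close>, so \<open>P\<^sub>K ((1 - cnj b a) f)\<close> is \<open>f\<close> minus the projection of
  \<open>cnj b a f\<close>.\<close>
lemma toeplitz_one_minus_eq_0_iff:
  assumes K: "closed_csubspace K" and a: "a \<in> Linf" and b: "b \<in> Linf"
  shows "toeplitz K K (\<lambda>z. 1 - cnj (b z) * a z) = (\<lambda>f\<in>K. 0)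
     \<longleftrightarrow> (\<forall>f\<in>K. proj_L2 K (mult_L2 (\<lambda>z. cnj (b z)) (mult_L2 a f)) = f)"
proof -
  have "proj_L2 K (mult_L2 (\<lambda>z. 1 - cnj (b z) * a z) f)
      = f - proj_L2 K (mult_L2 (\<lambda>z. cnj (b z)) (mult_L2 a f))" if "f \<in> K" for f
    using that K a b
    by (simp add: mult_L2_mult mult_L2_one_minus proj_L2_diff proj_L2_id Linf_mult Linf_cnj)
  thus ?thesis by (auto simp: toeplitz_def fun_eq_iff restrict_def)
qed

text \<open>The left-hand side says \<open>\<langle>a f, a g\<rangle> = \<langle>f, g\<rangle>\<close> for all \<open>f, g \<in> K\<close>. The diagonal \<open>f = g\<close> is
  the isometry condition, and polarization recovers the general case from it.\<close>
lemma proj_mult_cnj_mult_eq_iff_isometric: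
  assumes K: "closed_csubspace K" and a: "a \<in> Linf"
  shows "(\<forall>f\<in>K. proj_L2 K (mult_L2 (\<lambda>z. cnj (a z)) (mult_L2 a f)) = f)
     \<longleftrightarrow> (\<forall>f\<in>K. norm (mult_L2 a f) = norm f)"
proof (intro iffI ballI)
  fix f assume f: "f \<in> K"
    and "\<forall>f\<in>K. proj_L2 K (mult_L2 (\<lambda>z. cnj (a z)) (mult_L2 a f)) = f"
  hence "cinner_L2 (mult_L2 (\<lambda>z. cnj (a z)) (mult_L2 a f)) f = cinner_L2 f f"
    using proj_L2_orthogonal[OF K f, of "mult_L2 (\<lambda>z. cnj (a z)) (mult_L2 a f)"]
    by (simp add: cinner_L2_diff_left)
  thus "norm (mult_L2 a f) = norm f"
    by (simp add: cinner_mult_cnj_L2[OF a] norm_eq_sqrt_inner inner_L2_def)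
next
  fix f assume f: "f \<in> K" and iso: "\<forall>f\<in>K. norm (mult_L2 a f) = norm f"
  have inner: "inner (mult_L2 a f) (mult_L2 a g) = inner f g" if "g \<in> K" for g
    using that f K iso by (simp add: dot_norm closed_csubspace_def flip: mult_L2_add)
  have "cinner_L2 (mult_L2 a f) (mult_L2 a g) = cinner_L2 f g" if "g \<in> K" for g
    using that K inner by (simp add: cinner_L2_eq closed_csubspace_def flip: mult_L2_scaleC)
  thus "proj_L2 K (mult_L2 (\<lambda>z. cnj (a z)) (mult_L2 a f)) = f"
    using f by (intro proj_L2_eqI[OF K]) (auto simp: cinner_L2_diff_left cinner_mult_cnj_L2[OF a])
qed

section \<open>The equivalence\<close>

theorem corollary2p21:
  fixes H K :: "L2 set" and a1 a2 \<phi> \<psi> :: "complex \<Rightarrow> complex" and E F :: "L2 \<Rightarrow> L2"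
  assumes "closed_csubspace H" and "closed_csubspace K"
    and "a1 \<in> GLinf" and "a2 \<in> GLinf"
    and "mult_L2 a1 ` K = H" and "mult_L2 a2 ` K = H"
    and "\<phi> \<in> Linf" and "\<psi> \<in> Linf"
    and "AE z in circle_measure. \<phi> z = cnj (a2 z) * \<psi> z * a1 z"
    and "E = toeplitz H K (\<lambda>z. cnj (a2 z))"
    and "F = toeplitz K H a1"
  shows "F = restrict (mult_L2 a1) K \<and>
    toeplitz K K \<phi> = compose K E (compose K (toeplitz H H \<psi>) F) \<and>
    (is_unitary_equivalence K H (toeplitz K K \<phi>) E (toeplitz H H \<psi>) F
       \<longleftrightarrow> E = inverse_op K H F \<and> inverse_op K H F = adjoint_op K H F) \<and>
    (E = inverse_op K H F \<and> inverse_op K H F = adjoint_op K H F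
       \<longleftrightarrow> toeplitz K K (\<lambda>z. 1 - cnj (a2 z) * a1 z) = (\<lambda>f\<in>K. 0) \<and>
           toeplitz K K (\<lambda>z. 1 - complex_of_real ((cmod (a1 z))\<^sup>2)) = (\<lambda>f\<in>K. 0))"
proof -
  note H = assms(1) and K = assms(2) and a1K = assms(5) and a2K = assms(6)
  have a1: "a1 \<in> Linf" and a2: "a2 \<in> Linf" using assms(3,4) by (auto simp: GLinf_def)
  have bij: "bij_betw (mult_L2 a1) K H"
    using a1K mult_L2_inverse[OF assms(3)] unfolding bij_betw_def by (metis inj_on_inverseI)
  have F: "F = restrict (mult_L2 a1) K"
    unfolding assms(11) using H a1K by (intro toeplitz_eq_restrict_mult) auto
  have factor: "toeplitz K K \<phi> = compose K E (compose K (toeplitz H H \<psi>) F)"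
  proof
    fix f
    have "mult_L2 \<phi> f = mult_L2 (\<lambda>z. cnj (a2 z)) (mult_L2 \<psi> (mult_L2 a1 f))"
      using assms(7-9) a1 a2
      by (auto simp: mult_L2_mult Linf_mult Linf_cnj mult.assoc intro!: mult_L2_cong_AE)
    moreover have "mult_L2 a1 f \<in> H" if "f \<in> K" using that a1K by blast
    ultimately show "toeplitz K K \<phi> f = compose K E (compose K (toeplitz H H \<psi>) F) f"
      using proj_L2_mem[OF H] proj_mult_cnj_proj[OF K H a2] a2K
      by (simp add: F assms(10) toeplitz_def compose_def restrict_def)
  qed
  have adjoint: "inverse_op K H F = adjoint_op K H F \<longleftrightarrow> (\<forall>f\<in>K. norm (mult_L2 a1 f) = norm f)"
    unfolding F adjoint_op_restrict_mult[OF a1] proj_mult_cnj_mult_eq_iff_isometric[OF K a1, symmetric]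
      toeplitz_cnj_eq_inverse_iff[OF bij, symmetric] by (rule eq_commute)
  have "unitary_op K H F \<longleftrightarrow> (\<forall>f\<in>K. norm (mult_L2 a1 f) = norm f)"
    using K bij unfolding unitary_op_def F
    by (auto simp: closed_csubspace_def mult_L2_add mult_L2_scaleC cong: bij_betw_cong)
  hence ab: "is_unitary_equivalence K H (toeplitz K K \<phi>) E (toeplitz H H \<psi>) F
       \<longleftrightarrow> E = inverse_op K H F \<and> inverse_op K H F = adjoint_op K H F"
    using factor adjoint by (auto simp: is_unitary_equivalence_def)
  have "toeplitz K K (\<lambda>z. 1 - cnj (a2 z) * a1 z) = (\<lambda>f\<in>K. 0) \<longleftrightarrow> E = inverse_op K H F"
    unfolding F assms(10) toeplitz_cnj_eq_inverse_iff[OF bij]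
    by (rule toeplitz_one_minus_eq_0_iff[OF K a1 a2])
  moreover have "(\<lambda>z. 1 - complex_of_real ((cmod (a1 z))\<^sup>2)) = (\<lambda>z. 1 - cnj (a1 z) * a1 z)"
    by (simp only: complex_norm_square mult.commute)
  hence "toeplitz K K (\<lambda>z. 1 - complex_of_real ((cmod (a1 z))\<^sup>2)) = (\<lambda>f\<in>K. 0)
      \<longleftrightarrow> inverse_op K H F = adjoint_op K H F"
    unfolding adjoint
    by (simp only: toeplitz_one_minus_eq_0_iff[OF K a1 a1] proj_mult_cnj_mult_eq_iff_isometric[OF K a1])
  ultimately show ?thesis using F factor ab by blast
qed

end
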